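(* Let $q\ge 2$ and let $I=(L(u,v))\subset S=k[x_1,\ldots,x_n]$ be a completely squarefree lexsegment ideal determined by the monomials $u=x_1x_{i_2}\cdots x_{i_q}=x_1x_F$, $2\leq i_2<\ldots<i_q\leq n$, and $v=x_{j_1}\cdots x_{j_q}$, $2\leq j_1<\ldots<j_q\leq n$, where $F=\{i_2,\ldots,i_q\}$. Let $\Delta$ be the simplicial complex with Stanley--Reisner ideal $I$. Let $s$ be the unique integer such that $j_i=j_1+(i-1)$ for all $1\leq i< s$ and $j_s\geq j_1+s$, and let $t$ be the cardinality of the set $\{x_G: G\subset[n],\ |G|=n-q,\ x_{F^c\setminus\{1\}}>_{lex}x_G\}$. Then the multiplicity of $k[\Delta]=S/I$ is $$e(k[\Delta])=\begin{cases} s-1, & \text{if } j_1<n-q,\\ s+t-1, & \text{if } j_1=n-q.\end{cases}$$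
   Context: $k$ is a field, $S=k[x_1,\ldots,x_n]$, $[n]=\{1,\ldots,n\}$. Monomials are ordered lexicographically with $x_1>x_2>\cdots>x_n$. $\mathrm{Mon}_q^s(S)$ is the set of squarefree monomials of degree $q$ in $S$. For $u,v\in \mathrm{Mon}_q^s(S)$, $L(u,v)=\{w\in \mathrm{Mon}_q^s(S): u\geq_{lex}w\geq_{lex} v\}$ is the squarefree lexsegment set determined by $u,v$. The (squarefree) shadow of a set $T$ of squarefree monomials is $\mathrm{Shad}(T)=\{wx_i: w\in T,\ x_i\nmid w,\ 1\leq i\leq n\}$; a squarefree lexsegment set (and the ideal it generates) is completely lexsegment if all of its iterated shadows are again squarefree lexsegment sets. For $A\subset[n]$, $x_A=\prod_{i\in A}x_i$ and $A^c=[n]\setminus A$. *)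

theory Defs
  imports "HOL-Library.Poly_Mapping" "HOL-Computational_Algebra.Polynomial"
begin

text \<open>
  Monomials are exponent vectors, so multiplication of monomials is addition.
  The library order on this type compares the exponents at the smallest index where the
  two vectors differ, i.e. it is the lexicographic order with \<open>x\<^sub>1 > x\<^sub>2 > \<dots> > x\<^sub>n\<close>.
\<close>

type_synonym monomial = "nat \<Rightarrow>\<^sub>0 nat"
type_synonym 'k mpoly = "monomial \<Rightarrow>\<^sub>0 'k"

definition x_mono :: "nat set \<Rightarrow> monomial" where
  "x_mono A = (\<Sum>i\<in>A. Poly_Mapping.single i 1)"

definition mono_deg :: "monomial \<Rightarrow> nat" where
  "mono_deg w = (\<Sum>i\<in>Poly_Mapping.keys w. Poly_Mapping.lookup w i)"

definition sqfree_mono :: "nat \<Rightarrow> nat \<Rightarrow> monomial set" where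
  "sqfree_mono n q = {w. Poly_Mapping.keys w \<subseteq> {1..n} \<and>
     (\<forall>i. Poly_Mapping.lookup w i \<le> 1) \<and> mono_deg w = q}"

definition sqfree_lexseg :: "nat \<Rightarrow> nat \<Rightarrow> monomial \<Rightarrow> monomial \<Rightarrow> monomial set" where
  "sqfree_lexseg n q u v = {w \<in> sqfree_mono n q. u \<ge> w \<and> w \<ge> v}"

definition shad :: "nat \<Rightarrow> monomial set \<Rightarrow> monomial set" where
  "shad n T = {w + x_mono {i} |w i. w \<in> T \<and> i \<in> {1..n} \<and> i \<notin> Poly_Mapping.keys w}"

text \<open>
  The empty set counts as a lexsegment set: the iterated shadows are empty in all degrees
  exceeding \<open>n\<close>, where there are no squarefree monomials to serve as end points.
\<close>

definition is_sqfree_lexseg_set :: "nat \<Rightarrow> monomial set \<Rightarrow> bool" where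
  "is_sqfree_lexseg_set n T \<longleftrightarrow> T = {} \<or>
     (\<exists>q. \<exists>u \<in> sqfree_mono n q. \<exists>v \<in> sqfree_mono n q. T = sqfree_lexseg n q u v)"

definition completely_sqfree_lexseg :: "nat \<Rightarrow> monomial set \<Rightarrow> bool" where
  "completely_sqfree_lexseg n T \<longleftrightarrow> (\<forall>i. is_sqfree_lexseg_set n ((shad n ^^ i) T))"

definition poly_ring :: "nat \<Rightarrow> 'k::field mpoly set" where
  "poly_ring n = {p. \<forall>w \<in> Poly_Mapping.keys p. Poly_Mapping.keys w \<subseteq> {1..n}}"

definition gen_ideal :: "nat \<Rightarrow> 'k::field mpoly set \<Rightarrow> 'k mpoly set" where
  "gen_ideal n G = {\<Sum>g\<in>A. c g * g |A c. finite A \<and> A \<subseteq> G \<and> (\<forall>g\<in>A. c g \<in> poly_ring n)}"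

definition mono_poly :: "monomial \<Rightarrow> 'k::field mpoly" where
  "mono_poly w = Poly_Mapping.single w 1"

definition simplicial_complex_on :: "nat set \<Rightarrow> nat set set \<Rightarrow> bool" where
  "simplicial_complex_on V \<Delta> \<longleftrightarrow>
     {} \<in> \<Delta> \<and> \<Delta> \<subseteq> Pow V \<and> (\<forall>G\<in>\<Delta>. \<forall>H. H \<subseteq> G \<longrightarrow> H \<in> \<Delta>)"

definition stanley_reisner_ideal :: "nat \<Rightarrow> nat set set \<Rightarrow> 'k::field mpoly set" where
  "stanley_reisner_ideal n \<Delta> = gen_ideal n {mono_poly (x_mono G) |G. G \<subseteq> {1..n} \<and> G \<notin> \<Delta>}"

definition scalar_mult :: "'k::field \<Rightarrow> 'k mpoly \<Rightarrow> 'k mpoly" where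
  "scalar_mult c p = Poly_Mapping.single 0 c * p"

lemma vector_space_scalar_mult: "vector_space scalar_mult"
  by unfold_locales
    (simp_all add: scalar_mult_def algebra_simps single_add mult_single flip: mult.assoc)

definition poly_ring_component :: "nat \<Rightarrow> nat \<Rightarrow> 'k::field mpoly set" where
  "poly_ring_component n m = {p \<in> poly_ring n. \<forall>w \<in> Poly_Mapping.keys p. mono_deg w = m}"

text \<open>
  For a homogeneous ideal \<open>I\<close>, the degree \<open>m\<close> component of \<open>S/I\<close> is the quotient of the
  finite-dimensional space \<open>S\<^sub>m\<close> by its subspace \<open>I \<inter> S\<^sub>m\<close>.
\<close>

definition hilbert_fun :: "nat \<Rightarrow> 'k::field mpoly set \<Rightarrow> nat \<Rightarrow> nat" where
  "hilbert_fun n I m =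
     vector_space.dim scalar_mult (poly_ring_component n m :: 'k mpoly set) -
     vector_space.dim scalar_mult (I \<inter> poly_ring_component n m)"

definition hilbert_poly :: "nat \<Rightarrow> 'k::field mpoly set \<Rightarrow> rat poly" where
  "hilbert_poly n I =
     (THE P. \<forall>\<^sub>F m in sequentially. poly P (of_nat m) = of_nat (hilbert_fun n I m))"

text \<open>
  Multiplicity of \<open>S/I\<close> for a homogeneous ideal \<open>I\<close>: if \<open>d = dim S/I > 0\<close>, the Hilbert polynomial
  has degree \<open>d - 1\<close> and its leading coefficient is \<open>e(S/I) / (d - 1)!\<close>; if \<open>d = 0\<close>, the Hilbert
  polynomial is zero and \<open>e(S/I)\<close> is the length of \<open>S/I\<close>.
\<close>

definition multiplicity_quot :: "nat \<Rightarrow> 'k::field mpoly set \<Rightarrow> rat" where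
  "multiplicity_quot n I =
     (if hilbert_poly n I = 0 then of_nat (\<Sum>m | hilbert_fun n I m \<noteq> 0. hilbert_fun n I m)
      else fact (degree (hilbert_poly n I)) * lead_coeff (hilbert_poly n I))"

text \<open>
  \<open>first_gap q j s\<close>: \<open>j\<^sub>i = j\<^sub>1 + (i - 1)\<close> for \<open>1 \<le> i < s\<close>, and \<open>j\<^sub>s \<ge> j\<^sub>1 + s\<close>, with the convention
  \<open>j\<^bsub>q+1\<^esub> = \<infinity>\<close>; thus \<open>s = q + 1\<close> if \<open>j\<^sub>1, \<dots>, j\<^sub>q\<close> are consecutive.
\<close>

definition first_gap :: "nat \<Rightarrow> (nat \<Rightarrow> nat) \<Rightarrow> nat \<Rightarrow> bool" where
  "first_gap q j s \<longleftrightarrow> 1 \<le> s \<and> s \<le> q + 1 \<and>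
     (\<forall>i. 1 \<le> i \<and> i < s \<longrightarrow> j i = j 1 + (i - 1)) \<and> (s \<le> q \<longrightarrow> j s \<ge> j 1 + s)"

lemma ex1_first_gap:
  assumes "strict_mono_on {1..q} j"
  shows "\<exists>!s. first_gap q j s"
proof (rule ex_ex1I)
  define P where "P s \<longleftrightarrow> 1 \<le> s \<and> (s \<le> q \<longrightarrow> j s \<noteq> j 1 + (s - 1))" for s
  have "P (q + 1)" by (simp add: P_def)
  define s where "s = Least P"
  have Ps: "P s" and le: "s \<le> q + 1"
    unfolding s_def using \<open>P (q + 1)\<close> by (auto intro: LeastI Least_le)
  have less: "j i = j 1 + (i - 1)" if "1 \<le> i" "i < s" for i
  proof -
    have "\<not> P i" using not_less_Least[of i P] that(2) by (simp add: s_def)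
    then show ?thesis using that(1) by (simp add: P_def)
  qed
  have "j s \<ge> j 1 + s" if "s \<le> q"
  proof (cases "s = 1")
    case True
    then show ?thesis using Ps that by (simp add: P_def)
  next
    case False
    with Ps have s: "s \<ge> 2" by (auto simp: P_def)
    have "j (s - 1) < j s"
      by (rule strict_mono_onD[OF assms]) (use s that in auto)
    moreover have "j (s - 1) = j 1 + (s - 2)"
      using less[of "s - 1"] s by (simp add: numeral_2_eq_2)
    ultimately show ?thesis using Ps that s unfolding P_def by linarith
  qed
  then show "\<exists>s. first_gap q j s"
    using Ps le less unfolding first_gap_def P_def by blast
next
  fix s s' assume *: "first_gap q j s" "first_gap q j s'"
  have aux: "\<not> a < b" if "first_gap q j a" "first_gap q j b" for a b
  proof
    assume "a < b"
    with that have "1 \<le> a" "a \<le> q" "j a = j 1 + (a - 1)" "j a \<ge> j 1 + a"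
      unfolding first_gap_def by (blast, linarith, blast, linarith)
    then show False by linarith
  qed
  show "s = s'" using aux[OF *] aux[OF *(2,1)] by simp
qed

end

theory Submission
  imports Defs
begin

text \<open>
  The monomials outside a squarefree monomial ideal are those supported on a face of its simplicial
  complex, and there are \<open>m choose (card G - 1)\<close> of degree \<open>m + 1\<close> with support \<open>G\<close>. Hence the
  multiplicity is the number of faces of maximal size.

  Complete lexsegmentness forces every set of size between \<open>q + 1\<close> and \<open>n - 1\<close> that contains \<open>1\<close> to be
  a nonface, so the faces of size greater than \<open>q\<close> are the subsets of \<open>{2..n}\<close> all of whose
  \<open>q\<close>-subsets lie below \<open>v\<close>. The largest of these have size \<open>n - j\<^sub>1\<close> and arise from
  \<open>{j\<^sub>1..n}\<close> by deleting one of the first \<open>s - 1\<close> elements of \<open>v\<close>. If \<open>j\<^sub>1 = n - q\<close>, the maximal size is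
  \<open>q\<close> itself and the \<open>q\<close>-sets above \<open>u\<close> are facets as well; complementation, which reverses the
  lexicographic order, identifies them with the sets counted by \<open>t\<close>.
\<close>

section \<open>Squarefree monomials and their degrees\<close>

lemma lookup_x_mono:
  assumes "finite A"
  shows "Poly_Mapping.lookup (x_mono A) i = (if i \<in> A then 1 else 0)"
  using assms by (simp add: x_mono_def lookup_sum lookup_single when_def)

lemma keys_x_mono: "finite A \<Longrightarrow> Poly_Mapping.keys (x_mono A) = A"
  by (auto simp: in_keys_iff lookup_x_mono split: if_splits)

lemma inj_on_x_mono: "inj_on x_mono {A. finite A}"
  by (rule inj_on_inverseI[where g = Poly_Mapping.keys]) (simp add: keys_x_mono)

lemma x_mono_insert: "finite A \<Longrightarrow> i \<notin> A \<Longrightarrow> x_mono (insert i A) = x_mono A + x_mono {i}"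
  by (simp add: x_mono_def add.commute)

lemma mono_deg_superset:
  assumes "finite S" "Poly_Mapping.keys w \<subseteq> S"
  shows "mono_deg w = (\<Sum>i\<in>S. Poly_Mapping.lookup w i)"
  unfolding mono_deg_def using assms
  by (intro sum.mono_neutral_left) (auto simp: in_keys_iff)

lemma keys_add_nat:
  "Poly_Mapping.keys (w + w' :: monomial) = Poly_Mapping.keys w \<union> Poly_Mapping.keys w'"
  by (auto simp: in_keys_iff lookup_add)

lemma mono_deg_add: "mono_deg (w + w') = mono_deg w + mono_deg w'"
proof -
  let ?S = "Poly_Mapping.keys w \<union> Poly_Mapping.keys w'"
  have "mono_deg (w + w') = (\<Sum>i\<in>?S. Poly_Mapping.lookup (w + w') i)"
    by (rule mono_deg_superset) (auto simp: keys_add_nat)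
  also have "\<dots> = (\<Sum>i\<in>?S. Poly_Mapping.lookup w i) + (\<Sum>i\<in>?S. Poly_Mapping.lookup w' i)"
    by (simp add: lookup_add sum.distrib)
  also have "\<dots> = mono_deg w + mono_deg w'"
    using mono_deg_superset[of ?S w] mono_deg_superset[of ?S w'] by simp
  finally show ?thesis .
qed

lemma mono_deg_single: "mono_deg (Poly_Mapping.single a k) = k"
  by (simp add: mono_deg_def)

lemma mono_deg_x_mono: "finite A \<Longrightarrow> mono_deg (x_mono A) = card A"
  by (simp add: mono_deg_def keys_x_mono lookup_x_mono)

lemma sqfree_mono_eq: "sqfree_mono n q = x_mono ` {A. A \<subseteq> {1..n} \<and> card A = q}"
proof (intro equalityI subsetI)
  fix w assume w: "w \<in> sqfree_mono n q"
  define A where "A = Poly_Mapping.keys w"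
  have "Poly_Mapping.lookup w i = (if i \<in> A then 1 else 0)" for i
  proof -
    have "Poly_Mapping.lookup w i \<le> 1" using w by (simp add: sqfree_mono_def)
    then show ?thesis by (auto simp: A_def in_keys_iff)
  qed
  then have "w = x_mono A"
    by (intro poly_mapping_eqI) (simp add: lookup_x_mono A_def)
  moreover have "A \<subseteq> {1..n}" using w by (simp add: sqfree_mono_def A_def)
  moreover have "card A = q"
  proof -
    have "finite A" by (simp add: A_def)
    then have "card A = mono_deg w" unfolding \<open>w = x_mono A\<close> by (simp add: mono_deg_x_mono)
    also have "\<dots> = q" using w by (simp add: sqfree_mono_def)
    finally show ?thesis .
  qed
  ultimately show "w \<in> x_mono ` {A. A \<subseteq> {1..n} \<and> card A = q}" by blast
next
  fix w assume "w \<in> x_mono ` {A. A \<subseteq> {1..n} \<and> card A = q}"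
  then obtain A where "w = x_mono A" "A \<subseteq> {1..n}" "card A = q" by blast
  moreover have "finite A" using calculation(2) finite_subset by blast
  ultimately show "w \<in> sqfree_mono n q"
    by (auto simp: sqfree_mono_def keys_x_mono lookup_x_mono mono_deg_x_mono)
qed

section \<open>Monomials with prescribed support\<close>

definition support_mons :: "nat set \<Rightarrow> nat \<Rightarrow> monomial set" where
  "support_mons G m = {w. Poly_Mapping.keys w = G \<and> mono_deg w = m}"

lemma support_mons_0: "support_mons G 0 = (if G = {} then {0} else {})"
  by (auto simp: support_mons_def mono_deg_def in_keys_iff)

lemma support_mons_empty_Suc: "support_mons {} (Suc m) = {}"
  by (auto simp: support_mons_def mono_deg_def)

text \<open>Divide by the variable of index \<open>a\<close>: the quotient keeps the support
  \<open>G\<close> if the exponent of \<open>a\<close> exceeds 1 and loses \<open>a\<close> if it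
  equals 1.\<close>

lemma support_mons_Suc:
  assumes "a \<in> G"
  shows "support_mons G (Suc m) =
    (\<lambda>w. w + Poly_Mapping.single a 1) ` (support_mons G m \<union> support_mons (G - {a}) m)"
proof (intro equalityI subsetI)
  fix w assume w: "w \<in> support_mons G (Suc m)"
  define w' where "w' = w - Poly_Mapping.single a 1"
  have "Poly_Mapping.lookup w a \<noteq> 0"
    using w assms by (auto simp: support_mons_def in_keys_iff)
  then have w': "w = w' + Poly_Mapping.single a 1"
    by (intro poly_mapping_eqI)
      (auto simp: w'_def lookup_add lookup_minus lookup_single when_def)
  have "Poly_Mapping.keys w' = G \<or> Poly_Mapping.keys w' = G - {a}"
    using w assms by (auto simp: w' support_mons_def keys_add_nat)
  moreover have "mono_deg w' = m"
    using w by (simp add: w' support_mons_def mono_deg_add mono_deg_single)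
  ultimately show "w \<in> (\<lambda>w. w + Poly_Mapping.single a 1) ` (support_mons G m \<union> support_mons (G - {a}) m)"
    using w' by (auto simp: support_mons_def)
next
  fix w assume "w \<in> (\<lambda>w. w + Poly_Mapping.single a 1) ` (support_mons G m \<union> support_mons (G - {a}) m)"
  then obtain w' where w': "w = w' + Poly_Mapping.single a 1"
    "Poly_Mapping.keys w' = G \<or> Poly_Mapping.keys w' = G - {a}" "mono_deg w' = m"
    by (auto simp: support_mons_def)
  have "Poly_Mapping.keys w = G"
    using assms w'(2) unfolding w'(1) keys_add_nat
    by (metis Un_insert_right insert_Diff insert_absorb keys_single one_neq_zero sup_bot.right_neutral)
  then show "w \<in> support_mons G (Suc m)"
    using w' by (simp add: support_mons_def mono_deg_add mono_deg_single)
qed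

lemma finite_support_mons: "finite (support_mons G m)"
proof (induction m arbitrary: G)
  case 0
  then show ?case by (simp add: support_mons_0)
next
  case (Suc m)
  show ?case
  proof (cases "G = {}")
    case True
    then show ?thesis by (simp add: support_mons_empty_Suc)
  next
    case False
    then obtain a where "a \<in> G" by blast
    then show ?thesis using Suc by (simp add: support_mons_Suc)
  qed
qed

lemma card_support_mons_Suc:
  assumes "a \<in> G"
  shows "card (support_mons G (Suc m)) =
    card (support_mons G m) + card (support_mons (G - {a}) m)"
proof -
  have "support_mons G m \<inter> support_mons (G - {a}) m = {}"
    using assms by (auto simp: support_mons_def)
  then show ?thesis
    unfolding support_mons_Suc[OF assms]
    by (subst card_image) (auto simp: inj_on_def card_Un_disjoint finite_support_mons)
qed

text \<open>The recursion of \<open>card_support_mons_Suc\<close> becomes Pascal's rule for these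
  binomial coefficients.\<close>

lemma card_support_mons:
  assumes "finite G" "G \<noteq> {}"
  shows "card (support_mons G (Suc m)) = m choose (card G - 1)"
  using assms
proof (induction m arbitrary: G)
  case 0
  then obtain a where a: "a \<in> G" by blast
  have "card (G - {a}) = card G - 1" using a by simp
  moreover have "G - {a} = {} \<longleftrightarrow> card (G - {a}) = 0" using 0 by (simp add: card_eq_0_iff)
  ultimately show ?case
    using card_support_mons_Suc[OF a, of 0] 0 by (auto simp: support_mons_0 binomial_eq_0)
next
  case (Suc m)
  then obtain a where a: "a \<in> G" by blast
  have c: "card (G - {a}) = card G - 1" using a by simp
  show ?case
  proof (cases "G - {a} = {}")
    \<comment> \<open>For \<open>G = {a}\<close> the second summand of the recursion vanishes, as no
      monomial of positive degree has empty support.\<close>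
    case True
    then have "card G - 1 = 0" using c by (metis card.empty)
    then show ?thesis
      using card_support_mons_Suc[OF a, of "Suc m"] True Suc
      by (simp add: support_mons_empty_Suc)
  next
    case False
    then have "card (G - {a}) > 0" using Suc by (simp add: card_gt_0_iff)
    then obtain k where k: "card G - 1 = Suc k" using c by (metis gr0_implies_Suc)
    then show ?thesis
      using card_support_mons_Suc[OF a, of "Suc m"] Suc.IH[OF Suc.prems] Suc.IH[of "G - {a}"] False c Suc.prems
      by simp
  qed
qed

section \<open>Monomial ideals\<close>

lemma mono_poly_inj: "inj (mono_poly :: monomial \<Rightarrow> 'k::field mpoly)"
  by (rule injI) (metis keys_single mono_poly_def singleton_inject zero_neq_one)

lemma scalar_mult_mono_poly: "scalar_mult c (mono_poly w) = Poly_Mapping.single w c"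
  by (simp add: scalar_mult_def mono_poly_def mult_single)

lemma sum_single_lookup:
  fixes p :: "'k::field mpoly"
  shows "(\<Sum>w\<in>Poly_Mapping.keys p. Poly_Mapping.single w (Poly_Mapping.lookup p w)) = p"
  by (rule poly_mapping_eqI)
    (simp add: lookup_sum lookup_single when_def in_keys_iff)

text \<open>The monomials in \<open>M\<close> form a basis; independence follows by comparing
  coefficients.\<close>

lemma dim_keys_subset:
  assumes "finite M"
  shows "vector_space.dim scalar_mult {p :: 'k::field mpoly. Poly_Mapping.keys p \<subseteq> M} = card M"
proof -
  interpret vs: vector_space "scalar_mult :: 'k \<Rightarrow> _" by (rule vector_space_scalar_mult)
  let ?B = "mono_poly ` M :: 'k mpoly set"
  have inj: "inj_on (mono_poly :: _ \<Rightarrow> 'k mpoly) M"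
    by (rule inj_on_subset[OF mono_poly_inj]) simp
  show ?thesis
  proof (rule vs.dim_unique[of ?B])
    show "?B \<subseteq> {p. Poly_Mapping.keys p \<subseteq> M}"
      by (auto simp: mono_poly_def)
    show "{p :: 'k mpoly. Poly_Mapping.keys p \<subseteq> M} \<subseteq> vs.span ?B"
    proof
      fix p :: "'k mpoly" assume "p \<in> {p. Poly_Mapping.keys p \<subseteq> M}"
      then have "(\<Sum>w\<in>Poly_Mapping.keys p. scalar_mult (Poly_Mapping.lookup p w) (mono_poly w)) \<in> vs.span ?B"
        by (intro vs.span_sum vs.span_scale vs.span_base) auto
      then show "p \<in> vs.span ?B"
        by (simp add: scalar_mult_mono_poly sum_single_lookup)
    qed
    show "vs.independent ?B"
    proof (rule vs.independent_if_scalars_zero)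
      show "finite ?B" using assms by simp
      fix f and x :: "'k mpoly"
      assume eq: "(\<Sum>x\<in>?B. scalar_mult (f x) x) = 0" and "x \<in> ?B"
      then obtain w where w: "x = mono_poly w" "w \<in> M" by blast
      have "0 = (\<Sum>w'\<in>M. Poly_Mapping.single w' (f (mono_poly w')))"
        using eq by (simp add: sum.reindex[OF inj] scalar_mult_mono_poly)
      then have "0 = Poly_Mapping.lookup (\<Sum>w'\<in>M. Poly_Mapping.single w' (f (mono_poly w'))) w"
        by (metis lookup_zero)
      also have "\<dots> = f x"
        using assms w by (simp add: lookup_sum lookup_single when_def)
      finally show "f x = 0" by simp
    qed
    show "card ?B = card M" using inj by (rule card_image)
  qed
qed

text \<open>A monomial ideal is spanned by the multiples of its generators, so membership can be
  tested monomial by monomial.\<close>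

lemma gen_ideal_mono_poly:
  "gen_ideal n (mono_poly ` L) =
    {p :: 'k::field mpoly. Poly_Mapping.keys p \<subseteq>
      {g + h |g h. g \<in> L \<and> Poly_Mapping.keys h \<subseteq> {1..n}}}" (is "_ = {p. _ \<subseteq> ?M}")
proof (intro equalityI subsetI)
  fix p :: "'k mpoly" assume "p \<in> gen_ideal n (mono_poly ` L)"
  then obtain A c where A: "p = (\<Sum>g\<in>A. c g * g)" "finite A" "A \<subseteq> mono_poly ` L"
    "\<forall>g\<in>A. c g \<in> poly_ring n"
    unfolding gen_ideal_def by blast
  have "Poly_Mapping.keys (c g * g) \<subseteq> ?M" if g: "g \<in> A" for g
  proof
    fix w assume "w \<in> Poly_Mapping.keys (c g * g)"
    then obtain a b where ab: "w = a + b" "a \<in> Poly_Mapping.keys (c g)" "b \<in> Poly_Mapping.keys g"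
      using keys_mult by blast
    obtain l where "l \<in> L" "g = mono_poly l" using g A by blast
    then have "b \<in> L" using ab by (simp add: mono_poly_def)
    moreover have "Poly_Mapping.keys a \<subseteq> {1..n}" using ab g A by (auto simp: poly_ring_def)
    ultimately show "w \<in> ?M" using ab(1) add.commute by blast
  qed
  then have "Poly_Mapping.keys p \<subseteq> ?M"
    unfolding A(1) using keys_sum[of "\<lambda>g. c g * g" A] by blast
  then show "p \<in> {p. Poly_Mapping.keys p \<subseteq> ?M}" by blast
next
  fix p :: "'k mpoly" assume "p \<in> {p. Poly_Mapping.keys p \<subseteq> ?M}"
  then have "\<forall>w\<in>Poly_Mapping.keys p. \<exists>g h. w = g + h \<and> g \<in> L \<and> Poly_Mapping.keys h \<subseteq> {1..n}"
    by blast
  then obtain \<gamma> \<eta> where gh: "\<And>w. w \<in> Poly_Mapping.keys p \<Longrightarrow>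
      w = \<gamma> w + \<eta> w \<and> \<gamma> w \<in> L \<and> Poly_Mapping.keys (\<eta> w) \<subseteq> {1..n}"
    by metis
  define A :: "'k mpoly set" where "A = (\<lambda>w. mono_poly (\<gamma> w)) ` Poly_Mapping.keys p"
  \<comment> \<open>Several monomials of \<open>p\<close> may have been assigned the same generator,
    while \<open>gen_ideal\<close> allows one coefficient per generator; their cofactors are
    therefore collected.\<close>
  define c :: "'k mpoly \<Rightarrow> 'k mpoly" where
    "c g = (\<Sum>w | w \<in> Poly_Mapping.keys p \<and> mono_poly (\<gamma> w) = g.
       Poly_Mapping.single (\<eta> w) (Poly_Mapping.lookup p w))" for g
  have "(\<Sum>g\<in>A. c g * g) = (\<Sum>g\<in>A. \<Sum>w | w \<in> Poly_Mapping.keys p \<and> mono_poly (\<gamma> w) = g.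
      Poly_Mapping.single w (Poly_Mapping.lookup p w))"
    unfolding c_def sum_distrib_right
  proof (intro sum.cong refl)
    fix g :: "'k mpoly" and w assume w: "w \<in> {w \<in> Poly_Mapping.keys p. mono_poly (\<gamma> w) = g}"
    have "Poly_Mapping.single (\<eta> w) (Poly_Mapping.lookup p w) * g =
        Poly_Mapping.single (\<eta> w + \<gamma> w) (Poly_Mapping.lookup p w)"
      using w by (auto simp: mono_poly_def mult_single)
    also have "\<eta> w + \<gamma> w = w" using gh[of w] w by (simp add: add.commute)
    finally show "Poly_Mapping.single (\<eta> w) (Poly_Mapping.lookup p w) * g =
        Poly_Mapping.single w (Poly_Mapping.lookup p w)" .
  qed
  also have "\<dots> = p"
    unfolding A_def by (subst sum.image_gen[symmetric]) (simp_all add: sum_single_lookup)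
  finally have p: "p = (\<Sum>g\<in>A. c g * g)" by simp
  have "c g \<in> poly_ring n" for g
  proof -
    have "Poly_Mapping.keys (c g) \<subseteq> (\<Union>w\<in>{w \<in> Poly_Mapping.keys p. mono_poly (\<gamma> w) = g}. {\<eta> w})"
      unfolding c_def by (rule order_trans[OF keys_sum]) (auto split: if_splits)
    then show ?thesis using gh by (fastforce simp: poly_ring_def)
  qed
  moreover have "finite A" "A \<subseteq> mono_poly ` L" using gh by (auto simp: A_def)
  ultimately show "p \<in> gen_ideal n (mono_poly ` L)"
    unfolding gen_ideal_def using p by blast
qed

section \<open>Multiplicity of squarefree monomial ideals\<close>

text \<open>The Stanley-Reisner complex of the ideal generated by the \<open>x_mono A\<close> with
  \<open>A\<close> in \<N>, read off from the generators.\<close>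

definition faces :: "nat \<Rightarrow> nat set set \<Rightarrow> nat set set" where
  "faces n \<N> = {G. G \<subseteq> {1..n} \<and> (\<forall>A\<in>\<N>. \<not> A \<subseteq> G)}"

lemma finite_faces: "finite (faces n \<N>)"
  by (rule finite_subset[of _ "Pow {1..n}"]) (auto simp: faces_def)

text \<open>A monomial lies outside the ideal exactly when its support is a face. Such monomials of
  degree \<open>m\<close> represent a basis of the component of the quotient, and they are counted
  by support.\<close>

lemma hilbert_fun_faces:
  assumes "\<N> \<subseteq> Pow {1..n}"
  shows "hilbert_fun n (gen_ideal n (mono_poly ` x_mono ` \<N>) :: 'k::field mpoly set) m =
    (\<Sum>G\<in>faces n \<N>. card (support_mons G m))"
proof -
  define S where "S = {w. Poly_Mapping.keys w \<subseteq> {1..n} \<and> mono_deg w = m}"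
  define D where "D = (\<Union>G\<in>faces n \<N>. support_mons G m)"
  have fin: "finite A" if "A \<in> \<N>" for A
    using that assms finite_subset[of A "{1..n}"] by auto
  have "S = (\<Union>G\<in>Pow {1..n}. support_mons G m)"
    by (auto simp: S_def support_mons_def)
  then have "finite S" by (simp add: finite_support_mons)
  have comp: "poly_ring_component n m = {p :: 'k mpoly. Poly_Mapping.keys p \<subseteq> S}"
    by (auto simp: poly_ring_component_def poly_ring_def S_def)
  define M where "M = {g + h |g h. g \<in> x_mono ` \<N> \<and> Poly_Mapping.keys h \<subseteq> {1..n}}"
  have dvd: "w \<in> M \<longleftrightarrow>
      Poly_Mapping.keys w \<notin> faces n \<N>" if w: "w \<in> S" for w
    unfolding M_def
  proof
    assume "w \<in> {g + h |g h. g \<in> x_mono ` \<N> \<and> Poly_Mapping.keys h \<subseteq> {1..n}}"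
    then obtain A h where "A \<in> \<N>" "w = x_mono A + h" by blast
    then show "Poly_Mapping.keys w \<notin> faces n \<N>"
      by (auto simp: faces_def keys_add_nat keys_x_mono fin)
  next
    assume "Poly_Mapping.keys w \<notin> faces n \<N>"
    then obtain A where A: "A \<in> \<N>" "A \<subseteq> Poly_Mapping.keys w"
      using w by (auto simp: faces_def S_def)
    \<comment> \<open>Subtraction of exponents is truncated, but exact here because every exponent
      of \<open>w\<close> on \<open>A\<close> is positive.\<close>
    have "w = x_mono A + (w - x_mono A)"
    proof (rule poly_mapping_eqI)
      fix k
      have "k \<in> A \<Longrightarrow> Poly_Mapping.lookup w k \<noteq> 0" using A by (auto simp: in_keys_iff)
      then show "Poly_Mapping.lookup w k = Poly_Mapping.lookup (x_mono A + (w - x_mono A)) k"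
        using A by (auto simp: lookup_add lookup_minus lookup_x_mono fin)
    qed
    moreover have "Poly_Mapping.keys (w - x_mono A) \<subseteq> {1..n}"
      using w by (fastforce simp: S_def in_keys_iff lookup_minus subset_iff)
    ultimately show "w \<in> {g + h |g h. g \<in> x_mono ` \<N> \<and> Poly_Mapping.keys h \<subseteq> {1..n}}"
      using A by blast
  qed
  have DS: "D \<subseteq> S" by (auto simp: D_def S_def support_mons_def faces_def)
  have "w \<in> D \<longleftrightarrow> Poly_Mapping.keys w \<in> faces n \<N>" if "w \<in> S" for w
    using that by (auto simp: D_def S_def support_mons_def)
  with dvd have M: "M \<inter> S = S - D"
    by blast
  have "gen_ideal n (mono_poly ` x_mono ` \<N>) = {p :: 'k mpoly. Poly_Mapping.keys p \<subseteq> M}"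
    unfolding M_def by (rule gen_ideal_mono_poly)
  then have "gen_ideal n (mono_poly ` x_mono ` \<N>) \<inter> poly_ring_component n m =
      {p :: 'k mpoly. Poly_Mapping.keys p \<subseteq> S - D}"
    unfolding comp M[symmetric] by auto
  then have "hilbert_fun n (gen_ideal n (mono_poly ` x_mono ` \<N>) :: 'k mpoly set) m =
      card S - card (S - D)"
    using \<open>finite S\<close> by (simp add: hilbert_fun_def comp dim_keys_subset)
  also have "\<dots> = card D"
    using DS \<open>finite S\<close> finite_subset[OF DS] card_mono[OF \<open>finite S\<close> DS]
    by (simp add: card_Diff_subset)
  also have "\<dots> = (\<Sum>G\<in>faces n \<N>. card (support_mons G m))"
    unfolding D_def
    by (rule card_UN_disjoint) (auto simp: finite_faces finite_support_mons, auto simp: support_mons_def)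
  finally show ?thesis .
qed

section \<open>The Hilbert polynomial as a sum of binomial polynomials\<close>

text \<open>The binomial polynomial \<open>X - 1\<close> over \<open>k\<close>. The shift by 1
  matches \<open>card_support_mons\<close>, where degree \<open>Suc m\<close> gives
  \<open>m choose k\<close>.\<close>

definition choose_poly :: "nat \<Rightarrow> rat poly" where
  "choose_poly k = smult (1 / fact k) (\<Prod>i<k. [:- 1 - of_nat i, 1:])"

lemma poly_choose_poly: "poly (choose_poly k) (of_nat (Suc m)) = of_nat (m choose k)"
  by (simp add: choose_poly_def poly_prod binomial_gbinomial gbinomial_prod_rev
      atLeast0LessThan algebra_simps)

lemma degree_choose_poly: "degree (choose_poly k) = k"
  by (simp add: choose_poly_def degree_prod_eq_sum_degree)

lemma lead_coeff_choose_poly: "coeff (choose_poly k) k = 1 / fact k"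
proof -
  have "lead_coeff (choose_poly k) = 1 / fact k"
    unfolding choose_poly_def lead_coeff_smult lead_coeff_prod by simp
  then show ?thesis by (simp add: degree_choose_poly)
qed

text \<open>Otherwise the difference would be a nonzero polynomial with infinitely many roots. This
  gives the uniqueness behind the definite description in \<open>hilbert_poly\<close>.\<close>

lemma poly_eqI_eventually:
  fixes P Q :: "rat poly"
  assumes "\<forall>\<^sub>F m in sequentially. poly P (of_nat m) = poly Q (of_nat m)"
  shows "P = Q"
proof (rule ccontr)
  assume "P \<noteq> Q"
  then have fin: "finite {x. poly (P - Q) x = 0}" by (intro poly_roots_finite) simp
  obtain N where "\<And>m. m \<ge> N \<Longrightarrow> poly P (of_nat m) = poly Q (of_nat m)"
    using assms by (auto simp: eventually_sequentially)
  then have "of_nat ` {N..} \<subseteq> {x. poly (P - Q) x = 0}" by auto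
  then have "finite (of_nat ` {N..} :: rat set)" using fin finite_subset by blast
  then have "finite {N..}" by (rule finite_imageD) (simp add: inj_on_def)
  then show False by (simp add: infinite_Ici)
qed

text \<open>A nonempty face \<open>G\<close> contributes a polynomial of degree
  \<open>card G - 1\<close> to the Hilbert polynomial. Only faces of size \<open>d\<close> reach
  degree \<open>d - 1\<close>, each with leading coefficient \<open>1 / fact (d - 1)\<close>, so
  nothing cancels.\<close>

theorem multiplicity_quot_eq_card_facets:
  assumes "\<N> \<subseteq> Pow {1..n}" and "d \<ge> 1"
    and le: "\<And>G. G \<in> faces n \<N> \<Longrightarrow> card G \<le> d"
    and ex: "{G \<in> faces n \<N>. card G = d} \<noteq> {}"
  shows "multiplicity_quot n (gen_ideal n (mono_poly ` x_mono ` \<N>) :: 'k::field mpoly set) =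
    of_nat (card {G \<in> faces n \<N>. card G = d})"
proof -
  let ?I = "gen_ideal n (mono_poly ` x_mono ` \<N>) :: 'k mpoly set"
  \<comment> \<open>The empty face is left out: it contributes to the Hilbert function in degree 0
    only.\<close>
  let ?F = "faces n \<N> - {{}}" and ?N = "card {G \<in> faces n \<N>. card G = d}"
  define P where "P = (\<Sum>G\<in>?F. choose_poly (card G - 1))"
  have fin: "finite G" if "G \<in> faces n \<N>" for G
    using that finite_subset[of G "{1..n}"] by (auto simp: faces_def)
  have hilb: "hilbert_fun n ?I (Suc m) = (\<Sum>G\<in>?F. m choose (card G - 1))" for m
  proof -
    have "hilbert_fun n ?I (Suc m) = (\<Sum>G\<in>faces n \<N>. card (support_mons G (Suc m)))"
      by (rule hilbert_fun_faces[OF assms(1)])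
    also have "\<dots> = (\<Sum>G\<in>?F. card (support_mons G (Suc m)))"
      by (rule sum.mono_neutral_right) (auto simp: finite_faces support_mons_empty_Suc)
    also have "\<dots> = (\<Sum>G\<in>?F. m choose (card G - 1))"
      by (rule sum.cong) (auto simp: card_support_mons fin)
    finally show ?thesis .
  qed
  have "poly P (of_nat (Suc m)) = of_nat (hilbert_fun n ?I (Suc m))" for m
    unfolding P_def poly_sum poly_choose_poly hilb by simp
  then have "poly P (of_nat m) = of_nat (hilbert_fun n ?I m)" if "m \<ge> 1" for m
    using that by (metis Suc_le_D One_nat_def)
  then have ev: "\<forall>\<^sub>F m in sequentially. poly P (of_nat m) = of_nat (hilbert_fun n ?I m)"
    unfolding eventually_sequentially by blast
  have hp: "hilbert_poly n ?I = P"
    unfolding hilbert_poly_def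
  proof (rule the_equality)
    show "\<forall>\<^sub>F m in sequentially. poly P (of_nat m) = of_nat (hilbert_fun n ?I m)" by (rule ev)
    fix Q :: "rat poly" assume "\<forall>\<^sub>F m in sequentially. poly Q (of_nat m) = of_nat (hilbert_fun n ?I m)"
    with ev have "\<forall>\<^sub>F m in sequentially. poly Q (of_nat m) = poly P (of_nat m)"
      by eventually_elim simp
    then show "Q = P" by (rule poly_eqI_eventually)
  qed
  have deg: "degree P \<le> d - 1"
    unfolding P_def
    by (rule degree_sum_le) (auto simp: finite_faces degree_choose_poly intro!: diff_le_mono le)
  have "coeff P (d - 1) = (\<Sum>G\<in>?F. if card G = d then 1 / fact (d - 1) else 0)"
    unfolding P_def coeff_sum
  proof (rule sum.cong[OF refl])
    fix G assume G: "G \<in> ?F"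
    then have "card G > 0" "card G \<le> d" using fin le by (auto simp: card_gt_0_iff)
    then show "coeff (choose_poly (card G - 1)) (d - 1) = (if card G = d then 1 / fact (d - 1) else 0)"
      by (auto simp: lead_coeff_choose_poly intro!: coeff_eq_0 simp: degree_choose_poly)
  qed
  also have "\<dots> = of_nat (card {G \<in> ?F. card G = d}) / fact (d - 1)"
    by (subst sum.inter_filter[symmetric]) (simp_all add: finite_faces)
  also have "{G \<in> ?F. card G = d} = {G \<in> faces n \<N>. card G = d}"
    using assms(2) by auto
  finally have coeff: "coeff P (d - 1) = of_nat ?N / fact (d - 1)" .
  \<comment> \<open>A nonzero coefficient fixes the degree as \<open>d - 1\<close> and selects the
    second branch of \<open>multiplicity_quot\<close>.\<close>
  have "?N > 0" using ex finite_faces by (simp add: card_gt_0_iff)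
  then have "coeff P (d - 1) \<noteq> 0" unfolding coeff by simp
  then have "P \<noteq> 0" "degree P = d - 1"
    using deg le_degree[of P "d - 1"] by auto
  then show ?thesis
    using coeff by (simp add: multiplicity_quot_def hp)
qed

section \<open>The lexicographic order on squarefree monomials\<close>

text \<open>All exponents are 0 or 1, so the first difference is the least element \<open>k\<close>
  of the symmetric difference, and the larger monomial is the one containing it.\<close>

lemma x_mono_less_iff:
  assumes "finite A" "finite B"
  shows "x_mono A < x_mono B \<longleftrightarrow> (\<exists>k. k \<in> B \<and> k \<notin> A \<and> (\<forall>k'<k. k' \<in> A \<longleftrightarrow> k' \<in> B))"
proof -
  have "Poly_Mapping.lookup (x_mono A) k = Poly_Mapping.lookup (x_mono B) k \<longleftrightarrow> (k \<in> A \<longleftrightarrow> k \<in> B)"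
    "Poly_Mapping.lookup (x_mono A) k < Poly_Mapping.lookup (x_mono B) k \<longleftrightarrow> k \<in> B \<and> k \<notin> A" for k
    using assms by (auto simp: lookup_x_mono)
  then show ?thesis by (simp add: less_poly_mapping.rep_eq less_fun_def)
qed

lemma x_mono_lessI:
  assumes "finite A" "finite B" "k \<in> B" "k \<notin> A" "\<And>k'. k' < k \<Longrightarrow> k' \<in> A \<longleftrightarrow> k' \<in> B"
  shows "x_mono A < x_mono B"
  using assms by (auto simp: x_mono_less_iff)

text \<open>Complementation keeps the place of the first difference and swaps the set that owns
  it.\<close>

lemma x_mono_less_compl_iff:
  assumes "A \<subseteq> N" "B \<subseteq> N" "finite N"
  shows "x_mono (N - A) < x_mono (N - B) \<longleftrightarrow> x_mono B < x_mono A"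
proof -
  have "finite A" "finite B" using assms finite_subset by blast+
  then show ?thesis using assms by (simp add: x_mono_less_iff) blast
qed

text \<open>If \<open>A\<close> were larger, the first difference would lie beyond the segment, and
  \<open>A\<close> would contain the whole segment and one more element.\<close>

lemma x_mono_le_initial_segment:
  assumes "finite A" "A \<subseteq> {a..}" "card A = c"
  shows "x_mono A \<le> x_mono {a..<a + c}"
proof (rule ccontr)
  assume "\<not> ?thesis"
  then have "x_mono {a..<a + c} < x_mono A" by simp
  then obtain k where k: "k \<in> A" "k \<notin> {a..<a + c}" "\<forall>k'<k. k' \<in> {a..<a + c} \<longleftrightarrow> k' \<in> A"
    using assms(1) by (auto simp: x_mono_less_iff)
  then have "a + c \<le> k" using assms(2) by (auto simp: subset_iff)
  then have "insert k {a..<a + c} \<subseteq> A" using k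
    by (meson atLeastLessThan_iff insert_subset order_less_le_trans subsetI)
  then have "card (insert k {a..<a + c}) \<le> card A" using assms(1) card_mono by blast
  then show False using k(2) assms(3) by simp
qed

section \<open>Iterated shadows\<close>

lemma shad_x_mono:
  assumes "\<A> \<subseteq> Pow {1..n}"
  shows "shad n (x_mono ` \<A>) = x_mono ` {insert i A |A i. A \<in> \<A> \<and> i \<in> {1..n} \<and> i \<notin> A}"
proof -
  have fin: "finite A" if "A \<in> \<A>" for A
    using that assms finite_subset[of A "{1..n}"] by auto
  show ?thesis
  proof (intro equalityI subsetI)
    fix w assume "w \<in> shad n (x_mono ` \<A>)"
    then obtain A i where *: "w = x_mono A + x_mono {i}" "A \<in> \<A>" "i \<in> {1..n}" "i \<notin> A"
      by (auto simp: shad_def keys_x_mono fin)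
    then have "w = x_mono (insert i A)" using x_mono_insert[OF fin] by metis
    then show "w \<in> x_mono ` {insert i A |A i. A \<in> \<A> \<and> i \<in> {1..n} \<and> i \<notin> A}"
      using * by blast
  next
    fix w assume "w \<in> x_mono ` {insert i A |A i. A \<in> \<A> \<and> i \<in> {1..n} \<and> i \<notin> A}"
    then obtain A i where *: "w = x_mono (insert i A)" "A \<in> \<A>" "i \<in> {1..n}" "i \<notin> A" by blast
    then have "w = x_mono A + x_mono {i}" using x_mono_insert[OF fin] by metis
    moreover have "i \<notin> Poly_Mapping.keys (x_mono A)" using * by (simp add: keys_x_mono fin)
    ultimately show "w \<in> shad n (x_mono ` \<A>)" unfolding shad_def using * by blast
  qed
qed

text \<open>Each shadow adjoins one new element. Conversely, removing from \<open>G\<close> any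
  element outside \<open>A\<close> leads back to the previous shadow.\<close>

lemma iterated_shad_x_mono:
  assumes "\<A> \<subseteq> Pow {1..n}"
  shows "(shad n ^^ k) (x_mono ` \<A>) =
    x_mono ` {G. G \<subseteq> {1..n} \<and> (\<exists>A\<in>\<A>. A \<subseteq> G \<and> card G = card A + k)}"
proof (induction k)
  case 0
  have "G = A" if "A \<subseteq> G" "G \<subseteq> {1..n}" "card G = card A" for A G :: "nat set"
    using that card_subset_eq[of G A] finite_subset[of G "{1..n}"] by auto
  then have "{G. G \<subseteq> {1..n} \<and> (\<exists>A\<in>\<A>. A \<subseteq> G \<and> card G = card A + 0)} = \<A>"
    using assms by auto
  then show ?case by simp
next
  case (Suc k)
  let ?S = "\<lambda>k. {G. G \<subseteq> {1..n} \<and> (\<exists>A\<in>\<A>. A \<subseteq> G \<and> card G = card A + k)}"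
  have "{insert i B |B i. B \<in> ?S k \<and> i \<in> {1..n} \<and> i \<notin> B} = ?S (Suc k)"
  proof (intro equalityI subsetI)
    fix G assume "G \<in> {insert i B |B i. B \<in> ?S k \<and> i \<in> {1..n} \<and> i \<notin> B}"
    then obtain B i A where *: "G = insert i B" "B \<subseteq> {1..n}" "A \<in> \<A>" "A \<subseteq> B" "card B = card A + k"
      "i \<in> {1..n}" "i \<notin> B" by blast
    then have "card G = card A + Suc k" using finite_subset[of B "{1..n}"] by simp
    then show "G \<in> ?S (Suc k)" using * by blast
  next
    fix G assume "G \<in> ?S (Suc k)"
    then obtain A where *: "G \<subseteq> {1..n}" "A \<in> \<A>" "A \<subseteq> G" "card G = card A + Suc k" by blast
    then have "A \<noteq> G" by auto
    then obtain i where i: "i \<in> G" "i \<notin> A" using * by blast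
    have "card (G - {i}) = card A + k" using * i by simp
    then have "G - {i} \<in> ?S k" using * i by blast
    moreover have "G = insert i (G - {i})" using i by blast
    ultimately show "G \<in> {insert i B |B i. B \<in> ?S k \<and> i \<in> {1..n} \<and> i \<notin> B}" using * i by blast
  qed
  moreover have "?S k \<subseteq> Pow {1..n}" by blast
  ultimately show ?case using Suc by (simp add: shad_x_mono)
qed

text \<open>
  The shadow of degree \<open>p\<close> contains the largest squarefree monomial \<open>x\<^sub>1\<cdots>x\<^sub>p\<close> and a multiple of \<open>x\<^sub>V\<close>
  not divisible by \<open>x\<^sub>1\<close>. Being a lexsegment, it contains everything in between.
\<close>

lemma completely_lexseg_contains_1:
  assumes compl: "completely_sqfree_lexseg n (x_mono ` \<A>)"
    and \<A>: "\<And>A. A \<in> \<A> \<Longrightarrow> A \<subseteq> {1..n} \<and> card A = q"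
    and top: "{2..<2 + q} \<in> \<A>" and V: "V \<in> \<A>" "1 \<notin> V"
    and G: "G \<subseteq> {1..n}" "1 \<in> G" "q < card G" "card G < n"
  shows "\<exists>A\<in>\<A>. A \<subseteq> G"
proof -
  define p where "p = card G"
  define T where "T = (shad n ^^ (p - q)) (x_mono ` \<A>)"
  have "\<A> \<subseteq> Pow {1..n}" using \<A> by blast
  then have T: "T = x_mono ` {G. G \<subseteq> {1..n} \<and> (\<exists>A\<in>\<A>. A \<subseteq> G \<and> card G = card A + (p - q))}"
    unfolding T_def by (rule iterated_shad_x_mono)
  have fin: "finite G" using G finite_subset by blast
  have "{1..<1 + p} \<subseteq> {1..n}" "{2..<2 + q} \<subseteq> {1..<1 + p}"
    using G by (auto simp: p_def)
  moreover have "card {1..<1 + p} = card {2..<2 + q} + (p - q)" using G by (simp add: p_def)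
  ultimately have max: "x_mono {1..<1 + p} \<in> T" unfolding T using top by blast
  have "V \<subseteq> {2..n}"
  proof
    fix x assume "x \<in> V"
    then have "x \<in> {1..n}" "x \<noteq> 1" using V \<A> by blast+
    then show "x \<in> {2..n}" by auto
  qed
  \<comment> \<open>There is room for a set of size \<open>p\<close> between \<open>V\<close> and
    \<open>{2..n}\<close> because \<open>card G < n\<close>.\<close>
  moreover have "card V \<le> p" "p \<le> card {2..n}" using V \<A> G by (auto simp: p_def)
  ultimately obtain W where W: "V \<subseteq> W" "W \<subseteq> {2..n}" "card W = p"
    using exists_subset_between[of V p "{2..n}"] by auto
  have "card W = card V + (p - q)" using W V \<A> G by (simp add: p_def)
  moreover have "W \<subseteq> {1..n}" using W by auto
  ultimately have min: "x_mono W \<in> T" unfolding T using V W by blast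
  have finW: "finite W" using W finite_subset by blast
  have "is_sqfree_lexseg_set n T" using compl by (simp add: completely_sqfree_lexseg_def T_def)
  then obtain q' u' v' where T': "T = sqfree_lexseg n q' u' v'"
    using max by (auto simp: is_sqfree_lexseg_set_def)
  then have "q' = p"
    using max mono_deg_x_mono[of "{1..<1 + p}"] by (simp add: sqfree_lexseg_def sqfree_mono_def)
  \<comment> \<open>The index 1 decides the comparison, since it lies in \<open>G\<close> but not in
    \<open>W\<close>.\<close>
  have "x_mono W < x_mono G"
  proof (rule x_mono_lessI)
    show "1 \<in> G" "1 \<notin> W" "finite W" "finite G" using G W fin finW by (auto simp: subset_iff)
    show "k' \<in> W \<longleftrightarrow> k' \<in> G" if "k' < 1" for k' using that G W by (auto simp: subset_iff)
  qed
  moreover have "x_mono G \<le> x_mono {1..<1 + p}"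
    using G fin by (intro x_mono_le_initial_segment) (auto simp: p_def)
  moreover have "x_mono {1..<1 + p} \<le> u'" "v' \<le> x_mono W"
    using max min by (simp_all add: T' sqfree_lexseg_def)
  moreover have "x_mono G \<in> sqfree_mono n q'"
    using G \<open>q' = p\<close> by (auto simp: sqfree_mono_eq p_def)
  ultimately have "x_mono G \<in> T" unfolding T' sqfree_lexseg_def by auto
  then obtain G' A where "x_mono G = x_mono G'" "G' \<subseteq> {1..n}" "A \<in> \<A>" "A \<subseteq> G'" unfolding T by blast
  moreover have "G = G'"
    using calculation fin finite_subset[of G' "{1..n}"] inj_onD[OF inj_on_x_mono] by blast
  ultimately show ?thesis by blast
qed

section \<open>Sets all of whose \<open>q\<close>-subsets are below a given one\<close>

text \<open>An element \<open>g < p\<close> of \<open>G\<close> could be completed to a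
  \<open>q\<close>-subset of \<open>G\<close>. Such a subset exceeds \<open>V\<close>, which has no
  element before \<open>p\<close>.\<close>

lemma subset_atLeast_if_subsets_less:
  assumes "finite G" "finite V" "V \<subseteq> {p..}" "1 \<le> q" "q \<le> card G"
    and less: "\<And>A. A \<subseteq> G \<Longrightarrow> card A = q \<Longrightarrow> x_mono A < x_mono V"
  shows "G \<subseteq> {p..}"
proof (rule ccontr)
  assume "\<not> G \<subseteq> {p..}"
  then obtain g where g: "g \<in> G" "g < p" by (meson atLeast_iff not_le subsetI)
  then obtain A where A: "{g} \<subseteq> A" "A \<subseteq> G" "card A = q"
    using exists_subset_between[of "{g}" q G] assms by auto
  have "finite A" using A assms(1) finite_subset by blast
  obtain k where k: "k \<in> V" "\<forall>k'<k. k' \<in> A \<longleftrightarrow> k' \<in> V"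
    using less[OF A(2,3)] \<open>finite A\<close> assms(2) by (auto simp: x_mono_less_iff)
  have "g < k" using k g assms(3) by (auto simp: subset_iff)
  then have "g \<in> V" using k A by auto
  then show False using g assms(3) by (auto simp: subset_iff)
qed

text \<open>Here \<open>{p..<b}\<close> is the first block of consecutive elements of \<open>V\<close>.\<close>

lemma subsets_less_iff:
  assumes V: "V \<subseteq> {p..n}" "card V = q" "{p..<b} \<subseteq> V" "p < b" "b \<notin> V"
    and q: "1 \<le> q" "q \<le> n - p" and p: "1 \<le> p"
  shows "{G. G \<subseteq> {1..n} \<and> card G = n - p \<and> (\<forall>A. A \<subseteq> G \<longrightarrow> card A = q \<longrightarrow> x_mono A < x_mono V)} =
    (\<lambda>a. {p..n} - {a}) ` {p..<b}" (is "?L = ?R")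
proof (intro equalityI subsetI)
  have finV: "finite V" using V finite_subset by blast
  have pn: "p \<le> n" using q by simp
  fix G assume "G \<in> ?L"
  then have G: "G \<subseteq> {1..n}" "card G = n - p"
    and less: "\<And>A. A \<subseteq> G \<Longrightarrow> card A = q \<Longrightarrow> x_mono A < x_mono V" by blast+
  have fin: "finite G" using G finite_subset by blast
  have "V \<subseteq> {p..}" using V by (auto simp: subset_iff)
  then have "G \<subseteq> {p..}"
    by (rule subset_atLeast_if_subsets_less[OF fin finV _ q(1) _ less]) (use G q in auto)
  then have Gp: "G \<subseteq> {p..n}" using G by (auto simp: subset_iff)
  have "card ({p..n} - G) = 1"
    using card_Diff_subset[OF fin Gp] G pn by simp
  then obtain a where "{p..n} - G = {a}" by (auto simp: card_1_singleton_iff)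
  then have a: "G = {p..n} - {a}" "a \<in> {p..n}" using Gp by blast+
  \<comment> \<open>\<open>V\<close> is a \<open>q\<close>-set not below itself, so \<open>G\<close>
    cannot contain it; the missing element \<open>a\<close> must belong to \<open>V\<close>.\<close>
  have "\<not> V \<subseteq> G" using less[of V] V(2) by auto
  then have aV: "a \<in> V" using V a by blast
  have "a < b"
  proof (rule ccontr)
    assume "\<not> a < b"
    then have ab: "b < a" using aV V by (metis linorder_neqE_nat)
    \<comment> \<open>If \<open>a\<close> lies beyond the block, \<open>G\<close> still contains the
      block together with \<open>b\<close>. This set has at most \<open>q\<close> elements, as the
      block together with \<open>a\<close> fits into \<open>V\<close>; a \<open>q\<close>-subset of
      \<open>G\<close> containing it exceeds \<open>V\<close> at \<open>b\<close>.\<close>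
    let ?C = "insert b {p..<b}"
    have "insert a {p..<b} \<subseteq> V" using aV V by auto
    then have "card (insert a {p..<b}) \<le> q" using finV V card_mono by blast
    then have "card ?C \<le> q" using ab by simp
    moreover have "?C \<subseteq> G" using ab a V(4) by auto
    ultimately obtain A where A: "?C \<subseteq> A" "A \<subseteq> G" "card A = q"
      using exists_subset_between[of ?C q G] fin G q by auto
    have "finite A" using A fin finite_subset by blast
    then have "x_mono V < x_mono A"
    proof (rule x_mono_lessI[OF finV])
      show "b \<in> A" "b \<notin> V" using A V by auto
      show "k \<in> V \<longleftrightarrow> k \<in> A" if "k < b" for k
      proof (cases "p \<le> k")
        case True
        then have "k \<in> {p..<b}" using that by simp
        then show ?thesis using A V(3) by blast
      next
        case False
        then show ?thesis using V(1) A(2) Gp by (auto simp: subset_iff)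
      qed
    qed
    then show False using less[OF A(2,3)] by auto
  qed
  then show "G \<in> ?R" using a by auto
next
  have finV: "finite V" using V finite_subset by blast
  fix G assume "G \<in> ?R"
  then obtain a where a: "G = {p..n} - {a}" "a \<in> {p..<b}" by blast
  have aV: "a \<in> V" using a V by blast
  have "card G = n - p" using a aV V q by auto
  moreover have "G \<subseteq> {1..n}" using a p by auto
  moreover have "x_mono A < x_mono V" if "A \<subseteq> G" for A
  proof -
    \<comment> \<open>The first index from \<open>p\<close> on that \<open>A\<close> misses occurs
      no later than \<open>a\<close>, hence inside the block and in \<open>V\<close>; there
      \<open>V\<close> wins.\<close>
    define k where "k = (LEAST k. p \<le> k \<and> k \<notin> A)"
    have ex: "p \<le> a \<and> a \<notin> A" using a that by auto
    then have k: "p \<le> k \<and> k \<notin> A" "k \<le> a"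
      unfolding k_def by (rule LeastI, intro Least_le)
    have below: "l \<in> A" if "p \<le> l" "l < k" for l
      using not_less_Least[of l "\<lambda>k. p \<le> k \<and> k \<notin> A"] that by (auto simp: k_def)
    have "finite A" using that a finite_subset by blast
    then show ?thesis using finV
    proof (rule x_mono_lessI)
      have "k \<in> {p..<b}" using k a by auto
      then show "k \<in> V" using V by blast
      show "k \<notin> A" using k by blast
      show "l \<in> A \<longleftrightarrow> l \<in> V" if l: "l < k" for l
      proof (cases "p \<le> l")
        case True
        then have "l \<in> {p..<b}" using l k a by auto
        then show ?thesis using below[OF True l] V by blast
      next
        case False
        then show ?thesis using V(1) a \<open>A \<subseteq> G\<close> by (auto simp: subset_iff)
      qed
    qed
  qed
  ultimately show "G \<in> ?L" by blast
qed

lemma card_remove_one_image: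
  assumes "b \<le> Suc n"
  shows "card ((\<lambda>a. {p..n} - {a}) ` {p..<b}) = b - p"
proof -
  have "inj_on (\<lambda>a. {p..n} - {a}) {p..<b}"
  proof (rule inj_onI)
    fix x y assume "x \<in> {p..<b}" "y \<in> {p..<b}" "{p..n} - {x} = {p..n} - {y}"
    then show "x = y" using assms
      by (metis Diff_iff atLeastAtMost_iff atLeastLessThan_iff insertI1 less_Suc_eq_le
          order_less_le_trans singletonD)
  qed
  then show ?thesis by (simp add: card_image)
qed

section \<open>Faces of maximal size for a completely squarefree lexsegment ideal\<close>

theorem corollary2p16:
  fixes n q s t :: nat and i j :: "nat \<Rightarrow> nat" and F :: "nat set" and u v :: monomial
    and I :: "'k::field mpoly set" and \<Delta> :: "nat set set"
  assumes "q \<ge> 2"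
    and "strict_mono_on {2..q} i" and "\<forall>l\<in>{2..q}. 2 \<le> i l \<and> i l \<le> n"
    and "strict_mono_on {1..q} j" and "\<forall>l\<in>{1..q}. 2 \<le> j l \<and> j l \<le> n"
    and "F = i ` {2..q}"
    and "u = x_mono {1} + x_mono F"
    and "v = x_mono (j ` {1..q})"
    and "completely_sqfree_lexseg n (sqfree_lexseg n q u v)"
    and "I = gen_ideal n (mono_poly ` sqfree_lexseg n q u v)"
    and "simplicial_complex_on {1..n} \<Delta>"
    and "stanley_reisner_ideal n \<Delta> = I"
    and "first_gap q j s"
    and "t = card {x_mono G |G. G \<subseteq> {1..n} \<and> card G = n - q \<and>
                     x_mono (({1..n} - F) - {1}) > x_mono G}"
  shows "(j 1 < n - q \<longrightarrow> multiplicity_quot n I = of_nat s - 1) \<and>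
         (j 1 = n - q \<longrightarrow> multiplicity_quot n I = of_nat s + of_nat t - 1)"
proof -
  define p where "p = j 1"
  \<comment> \<open>The initial run of consecutive elements of \<open>v\<close> has
    \<open>s - 1\<close> members, from \<open>p\<close> to \<open>p + s - 2\<close>;
    \<open>b\<close> is the first index after it.\<close>
  define b where "b = p + s - 1"
  define U where "U = insert 1 F"
  define V where "V = j ` {1..q}"
  define \<A> where "\<A> = {A. A \<subseteq> {1..n} \<and> card A = q \<and> x_mono A \<le> u \<and> v \<le> x_mono A}"
  have F: "F \<subseteq> {2..n}" "finite F" using assms(3) by (auto simp: assms(6))
  have U: "U \<subseteq> {1..n}" "finite U" "1 \<in> U"
  proof -
    have "2 \<le> j 1 \<and> j 1 \<le> n" using assms(1,5) by simp
    then show "U \<subseteq> {1..n}" using F by (auto simp: U_def subset_iff)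
  qed (use F in \<open>simp_all add: U_def\<close>)
  have u: "u = x_mono U"
  proof -
    have "1 \<notin> F" using F by (auto simp: subset_iff)
    then show ?thesis unfolding U_def assms(7) using x_mono_insert[OF F(2)] by (metis add.commute)
  qed
  have v: "v = x_mono V" by (simp add: V_def assms(8))
  have s1: "1 \<le> s" and sq: "s \<le> q + 1"
    and gap: "s \<le> q \<Longrightarrow> p + s \<le> j s"
    and consecutive: "\<And>l. 1 \<le> l \<Longrightarrow> l < s \<Longrightarrow> j l = p + (l - 1)"
    using assms(13) unfolding first_gap_def p_def by blast+
  have mono: "j k \<le> j l" if "k \<in> {1..q}" "l \<in> {1..q}" "k \<le> l" for k l
    using that strict_mono_onD[OF assms(4), of k l] by (cases "k = l") auto
  have V2: "V \<subseteq> {2..n}" using assms(5) by (auto simp: V_def)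
  have finV: "finite V" by (simp add: V_def)
  have cardV: "card V = q"
    using card_image[OF strict_mono_on_imp_inj_on[OF assms(4)]] by (simp add: V_def)
  have pV: "p \<in> V" using assms(1) by (auto simp: V_def p_def)
  have Vp: "V \<subseteq> {p..n}"
    using mono[of 1] assms(1,5) by (auto simp: V_def p_def)
  have block: "{p..<b} \<subseteq> V"
  proof
    fix x assume x: "x \<in> {p..<b}"
    define l where "l = x - p + 1"
    have "1 \<le> l" "l < s" using x by (auto simp: l_def b_def)
    then have "j l = x" "l \<in> {1..q}"
      using consecutive[of l] sq x by (auto simp: l_def)
    then show "x \<in> V" by (auto simp: V_def)
  qed
  \<comment> \<open>Entries of \<open>j\<close> before position \<open>s\<close> are less than
    \<open>b\<close>, and from position \<open>s\<close> on they are at least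
    \<open>p + s = b + 1\<close>.\<close>
  have bV: "b \<notin> V"
  proof
    assume "b \<in> V"
    then obtain l where l: "l \<in> {1..q}" "j l = b" by (auto simp: V_def)
    show False
    proof (cases "l < s")
      case True
      then have "j l = p + (l - 1)" using consecutive l by simp
      then show False using True l by (auto simp: b_def)
    next
      case False
      then have "p + s \<le> j s" "j s \<le> j l"
        using gap l s1 mono[of s l] by auto
      then show False using l s1 by (auto simp: b_def)
    qed
  qed
  \<comment> \<open>This amounts to \<open>s\<close> being at least 2, so the block is
    nonempty.\<close>
  have "p \<noteq> b" using pV bV by auto
  then have pb: "p < b" using s1 by (simp add: b_def)
  have bn: "b \<le> Suc n"
  proof -
    have "b - 1 \<in> V" using pb block by (auto intro!: subsetD[OF block])
    then show ?thesis using V2 by (auto simp: subset_iff)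
  qed
  have p2: "2 \<le> p" "p \<le> n" using pV V2 by (auto simp: subset_iff)
  have qn: "q + 1 \<le> n"
    using card_mono[OF _ V2] cardV assms(1) by simp
  have L: "sqfree_lexseg n q u v = x_mono ` \<A>"
    by (auto simp: sqfree_lexseg_def sqfree_mono_eq \<A>_def)
  have below_u: "x_mono A < u" if "A \<subseteq> {1..n}" "1 \<notin> A" for A
    unfolding u
  proof (rule x_mono_lessI)
    show "finite A" using that finite_subset by blast
    show "finite U" "1 \<in> U" "1 \<notin> A" using U that by auto
    show "k \<in> A \<longleftrightarrow> k \<in> U" if "k < 1" for k
      using that U \<open>A \<subseteq> {1..n}\<close> by (auto simp: subset_iff)
  qed
  have VA: "V \<in> \<A>"
  proof -
    have "V \<subseteq> {1..n}" "1 \<notin> V" using V2 by (auto simp: subset_iff)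
    then show ?thesis using below_u[of V] cardV by (simp add: \<A>_def v)
  qed
  \<comment> \<open>The largest \<open>q\<close>-set avoiding 1; its supersets give the largest
    monomials of the iterated shadows in \<open>completely_lexseg_contains_1\<close>.\<close>
  have top: "{2..<2 + q} \<in> \<A>"
  proof -
    have "{2..<2 + q} \<subseteq> {1..n}" using qn by auto
    moreover have "x_mono V \<le> x_mono {2..<2 + q}"
      using V2 finV cardV by (intro x_mono_le_initial_segment) auto
    ultimately show ?thesis using below_u[of "{2..<2 + q}"] by (auto simp: \<A>_def v)
  qed
  have no1: "1 \<notin> G" if G: "G \<in> faces n \<A>" "q < card G" for G
  proof
    assume "1 \<in> G"
    have sub: "G \<subseteq> {1..n}" using G by (simp add: faces_def)
    show False
    proof (cases "card G < n")
      case True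
      have "\<exists>A\<in>\<A>. A \<subseteq> G"
      proof (rule completely_lexseg_contains_1[OF _ _ top VA _ sub \<open>1 \<in> G\<close> G(2) True])
        show "completely_sqfree_lexseg n (x_mono ` \<A>)" using assms(9) L by simp
        show "A \<subseteq> {1..n} \<and> card A = q" if "A \<in> \<A>" for A using that by (simp add: \<A>_def)
        show "1 \<notin> V" using V2 by (auto simp: subset_iff)
      qed
      then show False using G by (auto simp: faces_def)
    next
      case False
      \<comment> \<open>The shadow argument needs a set of the same size avoiding 1, which the full
        set does not admit; but the full set contains \<open>V\<close>.\<close>
      then have "G = {1..n}" using sub card_subset_eq[of "{1..n}" G] card_mono[OF _ sub] by simp
      then show False using G VA by (auto simp: faces_def \<A>_def)
    qed
  qed
  \<comment> \<open>A \<open>q\<close>-set avoiding 1 is below \<open>u\<close>, so it can be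
    outside \<A> only by being below \<open>v\<close>.\<close>
  have below_v: "x_mono A < v" if "G \<in> faces n \<A>" "1 \<notin> G" "A \<subseteq> G" "card A = q" for A G
  proof -
    have "A \<notin> \<A>" "A \<subseteq> {1..n}" using that by (auto simp: faces_def)
    moreover have "x_mono A < u" using that calculation by (intro below_u) auto
    ultimately show ?thesis using that by (auto simp: \<A>_def)
  qed
  have face_le: "card G \<le> n - p" if G: "G \<in> faces n \<A>" and qp: "q \<le> n - p" for G
  proof (rule ccontr)
    assume "\<not> card G \<le> n - p"
    then have c: "n - p < card G" by simp
    have sub: "G \<subseteq> {1..n}" using G by (simp add: faces_def)
    then have fin: "finite G" using finite_subset by blast
    have "1 \<notin> G" using no1[OF G] c qp by simp
    then have "\<And>A. A \<subseteq> G \<Longrightarrow> card A = q \<Longrightarrow> x_mono A < x_mono V"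
      using below_v[OF G] v by blast
    moreover have "V \<subseteq> {p..}" using Vp by (auto simp: subset_iff)
    ultimately have "G \<subseteq> {p..}"
      using subset_atLeast_if_subsets_less[OF fin finV, of p q] c qp assms(1) by simp
    then have Gp: "G \<subseteq> {p..n}" using sub by (auto simp: subset_iff)
    \<comment> \<open>A face with more than \<open>n - p\<close> elements would fill
      \<open>{p..n}\<close> and hence contain \<open>V\<close>.\<close>
    have "card {p..n} \<le> card G" using c by simp
    then have "G = {p..n}" using card_seteq[OF _ Gp] by simp
    then show False using G VA Vp by (auto simp: faces_def)
  qed
  let ?Low = "(\<lambda>a. {p..n} - {a}) ` {p..<b}"
  have low: "{G. G \<subseteq> {1..n} \<and> card G = n - p \<and> (\<forall>A. A \<subseteq> G \<longrightarrow> card A = q \<longrightarrow> x_mono A < x_mono V)} = ?Low"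
    if "q \<le> n - p"
    by (rule subsets_less_iff[OF Vp cardV block pb bV]) (use assms(1) that p2 in auto)
  have "?Low \<noteq> {}" using pb by simp
  have cardLow: "card ?Low = s - 1"
    using card_remove_one_image[OF bn, of p] by (simp add: b_def)
  have mult: "multiplicity_quot n I = of_nat (card {G \<in> faces n \<A>. card G = n - p})"
    if "q \<le> n - p" "{G \<in> faces n \<A>. card G = n - p} \<noteq> {}"
    unfolding assms(10) L
    by (rule multiplicity_quot_eq_card_facets) (use that face_le assms(1) in \<open>auto simp: \<A>_def\<close>)

  \<comment> \<open>The case of maximal faces larger than \<open>q\<close>\<close>
  have "multiplicity_quot n I = of_nat s - 1" if lt: "j 1 < n - q"
  proof -
    have qp: "q < n - p" using lt by (simp add: p_def)
    have "{G \<in> faces n \<A>. card G = n - p} =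
        {G. G \<subseteq> {1..n} \<and> card G = n - p \<and> (\<forall>A. A \<subseteq> G \<longrightarrow> card A = q \<longrightarrow> x_mono A < x_mono V)}"
      (is "?A = ?B")
    proof (intro equalityI subsetI)
      fix G assume "G \<in> ?A"
      then show "G \<in> ?B" using no1[of G] below_v[of G] qp v by (auto simp: faces_def)
    next
      fix G assume G: "G \<in> ?B"
      have "\<not> A \<subseteq> G" if "A \<in> \<A>" for A
      proof
        assume "A \<subseteq> G"
        then have "x_mono A < v" using G v that by (auto simp: \<A>_def)
        then show False using that by (auto simp: \<A>_def)
      qed
      then show "G \<in> ?A" using G by (auto simp: faces_def)
    qed
    also have "\<dots> = ?Low" using low qp by simp
    finally have "{G \<in> faces n \<A>. card G = n - p} = ?Low" .
    then show ?thesis using mult qp cardLow \<open>?Low \<noteq> {}\<close> s1 by (simp add: of_nat_diff)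
  qed

  \<comment> \<open>The case of maximal faces of size \<open>q\<close>\<close>
  moreover have "multiplicity_quot n I = of_nat s + of_nat t - 1" if eq: "j 1 = n - q"
  proof -
    have qp: "q = n - p" using eq qn by (simp add: p_def)
    define High where "High = {G. G \<subseteq> {1..n} \<and> card G = q \<and> u < x_mono G}"
    have finHigh: "finite High"
      by (rule finite_subset[of _ "Pow {1..n}"]) (auto simp: High_def)
    have eq_sub: "A = G" if "A \<subseteq> G" "card A = card G" "G \<subseteq> {1..n}" for A G :: "nat set"
      using that card_subset_eq[of G A] finite_subset[of G "{1..n}"] by auto
    \<comment> \<open>A \<open>q\<close>-set is its own only \<open>q\<close>-subset, so the
      condition on all \<open>q\<close>-subsets reduces to the set itself being below
      \<open>v\<close>.\<close>
    have Low: "{G. G \<subseteq> {1..n} \<and> card G = q \<and> x_mono G < v} = ?Low"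
    proof -
      have "G \<subseteq> {1..n} \<and> card G = q \<and> x_mono G < v \<longleftrightarrow>
          G \<subseteq> {1..n} \<and> card G = n - p \<and> (\<forall>A. A \<subseteq> G \<longrightarrow> card A = q \<longrightarrow> x_mono A < x_mono V)" for G
      proof (cases "G \<subseteq> {1..n} \<and> card G = q")
        case True
        then have "A = G" if "A \<subseteq> G" "card A = q" for A using eq_sub that by simp
        then have "(\<forall>A. A \<subseteq> G \<longrightarrow> card A = q \<longrightarrow> x_mono A < x_mono V) \<longleftrightarrow> x_mono G < x_mono V"
          using True by blast
        then show ?thesis using True qp v by simp
      qed (use qp in auto)
      then show ?thesis using low qp by simp
    qed
    \<comment> \<open>At size \<open>q\<close> a face is simply a \<open>q\<close>-set outside the
      lexsegment, hence below \<open>v\<close> or above \<open>u\<close>; sets containing 1 are now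
      possible.\<close>
    have "{G \<in> faces n \<A>. card G = n - p} = {G. G \<subseteq> {1..n} \<and> card G = q \<and> G \<notin> \<A>}"
    proof -
      have "(\<forall>A\<in>\<A>. \<not> A \<subseteq> G) \<longleftrightarrow> G \<notin> \<A>" if "G \<subseteq> {1..n}" "card G = q" for G
        using eq_sub[of _ G] that by (auto simp: \<A>_def)
      then show ?thesis unfolding qp[symmetric] faces_def by blast
    qed
    also have "\<dots> = {G. G \<subseteq> {1..n} \<and> card G = q \<and> x_mono G < v} \<union> High"
      by (auto simp: \<A>_def High_def)
    finally have facets: "{G \<in> faces n \<A>. card G = n - p} = ?Low \<union> High"
      unfolding Low .
    have "v \<le> u" using VA by (auto simp: \<A>_def v)
    then have "?Low \<inter> High = {}" unfolding Low[symmetric] High_def by auto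
    then have "card (?Low \<union> High) = s - 1 + card High"
      using finHigh cardLow by (simp add: card_Un_disjoint)
    moreover have "t = card High"
    proof -
      let ?T = "{G. G \<subseteq> {1..n} \<and> card G = n - q \<and> x_mono G < x_mono ({1..n} - F - {1})}"
      \<comment> \<open>The bound in the definition of \<open>t\<close> is the complement of
        \<open>U\<close>, so complementation carries the sets above \<open>U\<close> to those below
        this bound.\<close>
      have compl: "{1..n} - F - {1} = {1..n} - U" by (auto simp: U_def)
      have "bij_betw (\<lambda>G. {1..n} - G) High ?T"
      proof (rule bij_betw_byWitness[where f' = "\<lambda>G. {1..n} - G"])
        have c: "card ({1..n} - G) = n - card G" if "G \<subseteq> {1..n}" for G
          using that finite_subset[OF that] by (simp add: card_Diff_subset)
        show "(\<lambda>G. {1..n} - G) ` High \<subseteq> ?T"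
        proof (rule image_subsetI)
          fix G assume G: "G \<in> High"
          then have "x_mono ({1..n} - G) < x_mono ({1..n} - U)"
            by (subst x_mono_less_compl_iff) (use U in \<open>auto simp: High_def u\<close>)
          then show "{1..n} - G \<in> ?T" using G c[of G] unfolding compl High_def by blast
        qed
        show "(\<lambda>G. {1..n} - G) ` ?T \<subseteq> High"
        proof
          fix H assume "H \<in> (\<lambda>G. {1..n} - G) ` ?T"
          then obtain G where G: "H = {1..n} - G" "G \<subseteq> {1..n}" "card G = n - q"
            "x_mono G < x_mono ({1..n} - U)" unfolding compl by blast
          have "{1..n} - H = G" using G by auto
          then have "x_mono ({1..n} - H) < x_mono ({1..n} - U)" using G by simp
          then have "x_mono U < x_mono H"
            by (subst (asm) x_mono_less_compl_iff) (use G U in auto)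
          moreover have "card H = q" using G c[of G] qn by simp
          ultimately show "H \<in> High" using G by (auto simp: High_def u)
        qed
      qed (auto simp: High_def)
      then have "card High = card ?T" by (rule bij_betw_same_card)
      \<comment> \<open>\<open>t\<close> counts monomials rather than index sets; the two counts
        agree because \<open>x_mono\<close> is injective on finite sets.\<close>
      also have "\<dots> = card (x_mono ` ?T)"
        by (rule card_image[symmetric], rule inj_on_subset[OF inj_on_x_mono])
          (auto intro: finite_subset)
      also have "x_mono ` ?T = {x_mono G |G. G \<subseteq> {1..n} \<and> card G = n - q \<and>
                     x_mono (({1..n} - F) - {1}) > x_mono G}" by blast
      finally show ?thesis using assms(14) by simp
    qed
    ultimately show ?thesis
      using mult[unfolded facets] qp \<open>?Low \<noteq> {}\<close> s1 by (simp add: of_nat_diff)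
  qed
  ultimately show ?thesis by blast
qed

end
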